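(* Let $n\ge 1$, let $H$ be a subgroup of the symmetry group (of order $48$) of the cube $\{0,1,\dots,n-1\}^3$, and let $S\subseteq\{0,1,\dots,n-1\}^3$ be an $H$-invariant set with no four distinct points coplanar. (i) If $H$ contains the central inversion or a rotatory reflection of order $6$, then $|S|\le 3$. (ii) If $H$ contains a reflection, then $|S|\le 5$. (iii) If $H$ contains a rotation of order $4$, then $S$ is contained in the axis of that rotation.
   Context: Let $c=\left(\tfrac{n-1}{2},\tfrac{n-1}{2},\tfrac{n-1}{2}\right)$. The symmetry group of the cube is the group of the $48$ isometries $g(x)=c+A(x-c)$ of $\mathbb{R}^3$, where $A$ is a $3\times3$ signed permutation matrix; it preserves $\{0,\dots,n-1\}^3$. The central inversion is the element with $A=-I$; a rotatory reflection of order $6$ is an element of order $6$ with $\det A=-1$; a reflection is an element with $A^2=I$, $\det A=-1$, $A\ne -I$ (i.e. the orthogonal reflection in a plane); a rotation of order $4$ is an element of order $4$ with $\det A=1$, and its axis is its line of fixed points in $\mathbb{R}^3$. A set $S$ is $H$-invariant if $h(S)=S$ for all $h\in H$. Coplanarity is in the usual sense of $\mathbb{R}^3$. *)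

theory Defs
  imports "HOL-Analysis.Analysis" "HOL-Algebra.Multiplicative_Group"
begin

definition grid_cube :: "nat \<Rightarrow> (real^3) set" where
  "grid_cube n = {x. \<forall>i. \<exists>k<n. x $ i = real k}"

definition cube_center :: "nat \<Rightarrow> real^3" where
  "cube_center n = (\<chi> i. (real n - 1) / 2)"

definition signed_perm_matrix :: "real^3^3 \<Rightarrow> bool" where
  "signed_perm_matrix A \<longleftrightarrow>
     (\<exists>p e. p permutes UNIV \<and> (\<forall>i. e i = 1 \<or> e i = - 1) \<and>
            A = (\<chi> i j. if j = p i then e i else 0))"

definition cube_map :: "nat \<Rightarrow> real^3^3 \<Rightarrow> real^3 \<Rightarrow> real^3" where
  "cube_map n A x = cube_center n + A *v (x - cube_center n)"

(* The elements are isometries of the whole space, not of the finite grid, so that the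
   group has 48 elements for every n, including n = 1. *)
definition cube_group :: "nat \<Rightarrow> (real^3 \<Rightarrow> real^3) monoid" where
  "cube_group n =
     \<lparr>carrier = {cube_map n A | A. signed_perm_matrix A}, mult = (\<circ>), one = id\<rparr>"

definition central_inversion :: "nat \<Rightarrow> real^3 \<Rightarrow> real^3" where
  "central_inversion n = cube_map n (- mat 1)"

(* Here and below, the matrix A is determined by g. *)
definition rotatory_reflection6 :: "nat \<Rightarrow> (real^3 \<Rightarrow> real^3) \<Rightarrow> bool" where
  "rotatory_reflection6 n g \<longleftrightarrow>
     (\<exists>A. signed_perm_matrix A \<and> g = cube_map n A \<and> det A = - 1) \<and>
     group.ord (cube_group n) g = 6"

definition cube_reflection :: "nat \<Rightarrow> (real^3 \<Rightarrow> real^3) \<Rightarrow> bool" where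
  "cube_reflection n g \<longleftrightarrow>
     (\<exists>A. signed_perm_matrix A \<and> g = cube_map n A \<and>
          A ** A = mat 1 \<and> det A = - 1 \<and> A \<noteq> - mat 1)"

definition rotation4 :: "nat \<Rightarrow> (real^3 \<Rightarrow> real^3) \<Rightarrow> bool" where
  "rotation4 n g \<longleftrightarrow>
     (\<exists>A. signed_perm_matrix A \<and> g = cube_map n A \<and> det A = 1) \<and>
     group.ord (cube_group n) g = 4"

definition axis_of :: "(real^3 \<Rightarrow> real^3) \<Rightarrow> (real^3) set" where
  "axis_of g = {x. g x = x}"

definition invariant_under :: "(real^3 \<Rightarrow> real^3) set \<Rightarrow> (real^3) set \<Rightarrow> bool" where
  "invariant_under H S \<longleftrightarrow> (\<forall>h\<in>H. h ` S = S)"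

definition no_four_coplanar :: "(real^3) set \<Rightarrow> bool" where
  "no_four_coplanar S \<longleftrightarrow> (\<forall>T\<subseteq>S. card T = 4 \<longrightarrow> \<not> coplanar T)"

lemma signed_perm_matrix_one: "signed_perm_matrix (mat 1)"
  unfolding signed_perm_matrix_def
  by (intro exI[of _ id] exI[of _ "\<lambda>_. 1"]) (auto simp: mat_def permutes_id vec_eq_iff)

lemma signed_perm_mult_entry:
  fixes p :: "3 \<Rightarrow> 3" and e :: "3 \<Rightarrow> real" and B :: "real^3^3"
  shows "((\<chi> i j. if j = p i then e i else 0) ** B) $ i $ j = e i * B $ p i $ j"
proof -
  have "((\<chi> i j. if j = p i then e i else 0) ** B) $ i $ j
      = (\<Sum>k\<in>UNIV. if k = p i then e i * B $ k $ j else 0)"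
    unfolding matrix_matrix_mult_def vec_lambda_beta by (rule sum.cong) auto
  then show ?thesis by simp
qed

lemma signed_perm_matrix_mult:
  assumes "signed_perm_matrix A" "signed_perm_matrix B"
  shows "signed_perm_matrix (A ** B)"
proof -
  obtain p e where p: "p permutes UNIV" "\<And>i. e i = 1 \<or> e i = - 1"
    and A: "A = (\<chi> i j. if j = p i then e i else 0)"
    using assms(1) unfolding signed_perm_matrix_def by blast
  obtain q f where q: "q permutes UNIV" "\<And>i. f i = 1 \<or> f i = - 1"
    and B: "B = (\<chi> i j. if j = q i then f i else 0)"
    using assms(2) unfolding signed_perm_matrix_def by blast
  have "A ** B = (\<chi> i j. if j = (q \<circ> p) i then e i * f (p i) else 0)"
    unfolding A by (simp add: vec_eq_iff signed_perm_mult_entry B)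
  moreover have "q \<circ> p permutes UNIV"
    using p(1) q(1) by (rule permutes_compose)
  moreover have "\<forall>i. e i * f (p i) = 1 \<or> e i * f (p i) = - 1"
  proof
    fix i show "e i * f (p i) = 1 \<or> e i * f (p i) = - 1"
      using p(2)[of i] q(2)[of "p i"] by auto
  qed
  ultimately show ?thesis
    unfolding signed_perm_matrix_def
    by (intro exI[of _ "q \<circ> p"] exI[of _ "\<lambda>i. e i * f (p i)"]) blast
qed

lemma signed_perm_matrix_inverse:
  assumes "signed_perm_matrix A"
  shows "\<exists>B. signed_perm_matrix B \<and> B ** A = mat 1"
proof -
  obtain p e where p: "p permutes UNIV" "\<And>i. e i = 1 \<or> e i = - 1"
    and A: "A = (\<chi> i j. if j = p i then e i else 0)"
    using assms unfolding signed_perm_matrix_def by blast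
  define B :: "real^3^3" where
    "B = (\<chi> i j. if j = inv_into UNIV p i then e (inv_into UNIV p i) else 0)"
  have "signed_perm_matrix B"
    unfolding signed_perm_matrix_def B_def
    using p permutes_inv[OF p(1)]
    by (intro exI[of _ "inv_into UNIV p"] exI[of _ "\<lambda>i. e (inv_into UNIV p i)"]) blast
  moreover have "B ** A = mat 1"
  proof -
    have "e k * e k = 1" for k
      using p(2)[of k] by auto
    then have "(B ** A) $ i $ j = mat 1 $ i $ j" for i j
      unfolding B_def signed_perm_mult_entry
      by (auto simp: A mat_def permutes_inverses(1)[OF p(1)])
    then show ?thesis by (simp add: vec_eq_iff)
  qed
  ultimately show ?thesis by blast
qed

lemma cube_map_one: "cube_map n (mat 1) = id"
  by (auto simp: cube_map_def)

lemma cube_map_comp: "cube_map n A \<circ> cube_map n B = cube_map n (A ** B)"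
  by (auto simp: cube_map_def matrix_vector_mul_assoc)

lemma group_cube_group: "group (cube_group n)"
proof (rule groupI)
  fix x assume "x \<in> carrier (cube_group n)"
  then obtain A where A: "signed_perm_matrix A" "x = cube_map n A"
    by (auto simp: cube_group_def)
  obtain B where B: "signed_perm_matrix B" "B ** A = mat 1"
    using signed_perm_matrix_inverse[OF A(1)] by blast
  have "cube_map n B \<circ> x = id"
    by (simp add: A(2) cube_map_comp B(2) cube_map_one)
  then show "\<exists>y\<in>carrier (cube_group n). y \<otimes>\<^bsub>cube_group n\<^esub> x = \<one>\<^bsub>cube_group n\<^esub>"
    using B(1) by (auto simp: cube_group_def)
next
  show "\<one>\<^bsub>cube_group n\<^esub> \<in> carrier (cube_group n)"
    using signed_perm_matrix_one cube_map_one[of n, symmetric] by (auto simp: cube_group_def)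
qed (auto simp: cube_group_def comp_assoc cube_map_comp intro: signed_perm_matrix_mult)

lemma order_cube_group: "order (cube_group n) = 48"
proof -
  let ?M = "\<lambda>(p, e). (\<chi> i j. if j = p i then e i else 0) :: real^3^3"
  let ?D = "{p::3 \<Rightarrow> 3. p permutes UNIV} \<times> ((UNIV :: 3 set) \<rightarrow>\<^sub>E {1, - 1::real})"
  have "inj_on ?M ?D"
  proof (rule inj_onI, clarify)
    fix p q :: "3 \<Rightarrow> 3" and e f :: "3 \<Rightarrow> real"
    assume e: "e \<in> UNIV \<rightarrow>\<^sub>E {1, - 1}"
      and eq: "(\<chi> i j. if j = p i then e i else 0) = ((\<chi> i j. if j = q i then f i else 0) :: real^3^3)"
    have *: "(if j = p i then e i else 0) = (if j = q i then f i else 0)" for i j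
      using arg_cong[OF eq, of "\<lambda>M. M $ i $ j"] by simp
    have "e i \<noteq> 0" for i
      using PiE_mem[OF e, of i] by auto
    then have "p i = q i \<and> e i = f i" for i
      using *[of "p i" i] by (auto split: if_splits)
    then show "p = q \<and> e = f" by auto
  qed
  then have "card (?M ` ?D) = card ?D"
    by (rule card_image)
  also have "\<dots> = 48"
    by (simp add: card_cartesian_product card_permutations card_PiE fact_numeral power3_eq_cube)
  finally have M: "card (?M ` ?D) = 48" .
  have D: "{A. signed_perm_matrix A} = ?M ` ?D"
  proof (intro equalityI subsetI)
    fix A assume "A \<in> {A. signed_perm_matrix A}"
    then obtain p e where pe: "p permutes UNIV" "\<forall>i. e i = 1 \<or> e i = - 1"
      and A: "A = ?M (p, e)"
      unfolding signed_perm_matrix_def by auto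
    have "(p, e) \<in> ?D"
      using pe by (simp add: PiE_UNIV_domain)
    then show "A \<in> ?M ` ?D"
      unfolding A by (rule imageI)
  next
    fix A assume "A \<in> ?M ` ?D"
    then obtain p e where pe: "p permutes UNIV" "e \<in> UNIV \<rightarrow>\<^sub>E {1, - 1::real}"
      and A: "A = ?M (p, e)"
      by blast
    have "\<forall>i. e i = 1 \<or> e i = - 1"
      using PiE_mem[OF pe(2)] by blast
    then show "A \<in> {A. signed_perm_matrix A}"
      unfolding signed_perm_matrix_def A using pe(1) by auto
  qed
  have "inj (cube_map n)"
  proof (rule injI)
    fix A B assume eq: "cube_map n A = cube_map n B"
    have "A *v x = B *v x" for x
      using fun_cong[OF eq, of "x + cube_center n"] by (simp add: cube_map_def)
    then show "A = B" by (simp add: matrix_eq)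
  qed
  then have "card (cube_map n ` {A. signed_perm_matrix A}) = card {A. signed_perm_matrix A}"
    by (meson card_image inj_on_subset subset_UNIV)
  moreover have "carrier (cube_group n) = cube_map n ` {A. signed_perm_matrix A}"
    by (auto simp: cube_group_def)
  ultimately show ?thesis
    by (simp add: order_def D M)
qed

end

theory Submission
  imports Defs
begin

text \<open>
  Each of the three hypotheses turns invariance into a planar quadruple. Two orbits of the central
  inversion form a parallelogram, and so does an orbit of a rotation of order 4 off its axis; two
  orbits of a reflection off its mirror form a trapezoid, and the mirror itself is a plane. The
  cube of a rotatory reflection of order 6 is the central inversion.
\<close>

section \<open>Coplanarity criteria\<close>

lemma coplanar_affine_combination:
  fixes a b c d :: "'a::euclidean_space"
  assumes "d = r *\<^sub>R a + s *\<^sub>R b + t *\<^sub>R c" "r + s + t = 1"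
  shows "coplanar {a, b, c, d}"
proof -
  have "d \<in> affine hull {a, b, c}"
    using assms unfolding affine_hull_3 by blast
  then show ?thesis
    unfolding coplanar_def using hull_subset[of "{a, b, c}" affine] by blast
qed

text \<open>The pairs \<open>a\<close>, \<open>b\<close> and \<open>c\<close>, \<open>d\<close> are
  the diagonals: they share a midpoint, so \<open>d = a + b - c\<close> is an affine
  combination.\<close>

lemma coplanar_parallelogram:
  fixes a b c d :: "'a::euclidean_space"
  assumes "a + b = c + d"
  shows "coplanar {a, b, c, d}"
  by (rule coplanar_affine_combination[of d 1 a 1 b "-1" c])
    (use assms in \<open>simp_all add: algebra_simps\<close>)

lemma no_four_coplanarD:
  assumes "no_four_coplanar S" "distinct [a, b, c, d]" "{a, b, c, d} \<subseteq> S"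
  shows "\<not> coplanar {a, b, c, d}"
proof -
  have "card {a, b, c, d} = 4"
    using assms(2) by simp
  then show ?thesis
    using assms(1,3) unfolding no_four_coplanar_def by blast
qed

text \<open>\<open>coplanar\<close> asks for three points whose affine hull contains the set. An
  affine basis of a plane in \<open>real^3\<close> consists of exactly three points.\<close>

lemma coplanar_hyperplane_3:
  fixes a :: "real^3"
  assumes "a \<noteq> 0"
  shows "coplanar {x. a \<bullet> x = b}"
proof -
  let ?P = "{x. a \<bullet> x = b}"
  obtain B where B: "\<not> affine_dependent B" "B \<subseteq> ?P" "affine hull B = affine hull ?P"
    using affine_basis_exists[of ?P] by blast
  have "aff_dim B = 2"
    using aff_dim_hyperplane[OF assms, of b] B(3)
      aff_dim_affine_hull[of B] aff_dim_affine_hull[of ?P] by simp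
  then have "card B = 3"
    using aff_dim_affine_independent[OF B(1)] by simp
  then obtain u v w where "B = {u, v, w}"
    by (auto simp: card_3_iff)
  then show ?thesis
    unfolding coplanar_def using B(3) hull_subset[of ?P affine] by blast
qed

section \<open>Signed permutation matrices in dimension three\<close>

definition monomial_matrices_3 :: "real \<Rightarrow> real \<Rightarrow> real \<Rightarrow> (real^3^3) set" where
  "monomial_matrices_3 a b c =
     {vector [vector [a, 0, 0], vector [0, b, 0], vector [0, 0, c]],
      vector [vector [a, 0, 0], vector [0, 0, b], vector [0, c, 0]],
      vector [vector [0, a, 0], vector [b, 0, 0], vector [0, 0, c]],
      vector [vector [0, a, 0], vector [0, 0, b], vector [c, 0, 0]],
      vector [vector [0, 0, a], vector [b, 0, 0], vector [0, c, 0]],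
      vector [vector [0, 0, a], vector [0, b, 0], vector [c, 0, 0]]}"

text \<open>Injectivity of \<open>p\<close> leaves six patterns of nonzero entries, with the signs
  of rows 1, 2, 3 as \<open>a\<close>, \<open>b\<close>, \<open>c\<close>. Matrix identities then
  reduce to entrywise computation in six cases.\<close>

lemma signed_perm_matrix_cases:
  assumes "signed_perm_matrix A"
  obtains a b c :: real where "\<bar>a\<bar> = 1" "\<bar>b\<bar> = 1" "\<bar>c\<bar> = 1" "A \<in> monomial_matrices_3 a b c"
proof -
  obtain p e where p: "p permutes UNIV" and e: "\<And>i. e i = 1 \<or> e i = - 1"
    and A: "A = (\<chi> i j. if j = p i then e i else 0)"
    using assms unfolding signed_perm_matrix_def by blast
  have "inj p"
    using permutes_inj[OF p] .
  then have "p 1 \<noteq> p 2" "p 1 \<noteq> p 3" "p 2 \<noteq> p 3"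
    by (simp_all add: inj_eq)
  moreover have "\<bar>e i\<bar> = 1" for i
    using e[of i] by auto
  ultimately show ?thesis
    using exhaust_3[of "p 1"] exhaust_3[of "p 2"] exhaust_3[of "p 3"]
    by (intro that[of "e 1" "e 2" "e 3"]) (auto simp: A monomial_matrices_3_def vec_eq_iff forall_3)
qed

lemmas matrix_3_simps = vec_eq_iff forall_3 det_3 sum_3 matrix_matrix_mult_def mat_def
  matrix_vector_mult_def

lemma abs_one_mult_self:
  fixes a :: real
  assumes "\<bar>a\<bar> = 1"
  shows "a * a = 1" "a * (a * x) = x"
proof -
  show "a * a = 1"
    using assms by (metis abs_mult_self_eq mult_1)
  then show "a * (a * x) = x"
    by (simp flip: mult.assoc)
qed

text \<open>If the permutation is a 3-cycle, the cube is the scalar \<open>a * b * c\<close>, which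
  is the determinant because a 3-cycle is even. Otherwise the square is diagonal with entries of
  absolute value 1, so the fourth power is the identity.\<close>

lemma signed_perm_matrix_power:
  assumes "signed_perm_matrix A"
  shows "A ** A ** A = det A *\<^sub>R mat 1 \<or> A ** A ** A ** A = mat 1"
proof -
  obtain a b c :: real where abc: "\<bar>a\<bar> = 1" "\<bar>b\<bar> = 1" "\<bar>c\<bar> = 1"
    and A: "A \<in> monomial_matrices_3 a b c"
    using signed_perm_matrix_cases[OF assms] .
  show ?thesis
    using A unfolding monomial_matrices_3_def
    by (elim insertE emptyE)
      (simp_all add: matrix_3_simps abs_one_mult_self[OF abc(1)] abs_one_mult_self[OF abc(2)]
        abs_one_mult_self[OF abc(3)] mult_ac)
qed

text \<open>Here \<open>v\<close> is a normal of the mirror and \<open>k\<close> is 2 divided by the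
  squared length of \<open>v\<close>.\<close>

lemma signed_perm_matrix_reflection:
  assumes "signed_perm_matrix A" "A ** A = mat 1" "det A = - 1" "A \<noteq> - mat 1"
  obtains v k where "v \<noteq> 0" "k \<noteq> 0" "\<And>x. A *v x = x - (k * (v \<bullet> x)) *\<^sub>R v"
proof -
  obtain a b c :: real where abc: "\<bar>a\<bar> = 1" "\<bar>b\<bar> = 1" "\<bar>c\<bar> = 1"
    and A: "A \<in> monomial_matrices_3 a b c"
    using signed_perm_matrix_cases[OF assms(1)] .
  have sgn: "a = 1 \<or> a = - 1" "b = 1 \<or> b = - 1" "c = 1 \<or> c = - 1"
    using abc by linarith+
  show thesis
    using A unfolding monomial_matrices_3_def
  proof (elim insertE emptyE)
    assume A: "A = vector [vector [a, 0, 0], vector [0, b, 0], vector [0, 0, c]]"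
    show thesis
      \<comment> \<open>The entry \<open>(1 - a) / 2\<close> is 1 if \<open>a = - 1\<close> and 0 if
        \<open>a = 1\<close>. Exactly one sign is negative, so this is a coordinate vector.\<close>
      by (rule that[of "vector [(1 - a) / 2, (1 - b) / 2, (1 - c) / 2]" 2])
        (use sgn assms(2-) in \<open>auto simp: A matrix_3_simps inner_vec_def\<close>)
  next
    assume A: "A = vector [vector [a, 0, 0], vector [0, 0, b], vector [0, c, 0]]"
    show thesis
      \<comment> \<open>\<open>A ** A = mat 1\<close> forces \<open>b = c\<close>, so
        \<open>A\<close> maps this vector to its negative; the determinant then gives
        \<open>a = 1\<close>.\<close>
      by (rule that[of "vector [0, 1, - b]" 1])
        (use sgn assms(2-) in \<open>auto simp: A matrix_3_simps inner_vec_def\<close>)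
  next
    assume A: "A = vector [vector [0, a, 0], vector [b, 0, 0], vector [0, 0, c]]"
    show thesis
      by (rule that[of "vector [1, - a, 0]" 1])
        (use sgn assms(2-) in \<open>auto simp: A matrix_3_simps inner_vec_def\<close>)
  next
    assume A: "A = vector [vector [0, 0, a], vector [0, b, 0], vector [c, 0, 0]]"
    show thesis
      by (rule that[of "vector [1, 0, - a]" 1])
        (use sgn assms(2-) in \<open>auto simp: A matrix_3_simps inner_vec_def\<close>)
  \<comment> \<open>The two cyclic patterns remain; the square of a 3-cycle is not the
    identity.\<close>
  qed (use sgn assms(2) in \<open>auto simp: matrix_3_simps\<close>)
qed

text \<open>The identity says \<open>(1 - A) * (1 + A^2) = 0\<close>. A quarter turn is the identity
  on its axis and squares to minus the identity on the orthogonal plane, so one factor vanishes on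
  each.\<close>

lemma signed_perm_matrix_rotation4:
  assumes "signed_perm_matrix A" "det A = 1" "A ** A \<noteq> mat 1" "A ** A ** A \<noteq> mat 1"
  shows "mat 1 + A ** A = A + A ** A ** A"
proof -
  obtain a b c :: real where abc: "\<bar>a\<bar> = 1" "\<bar>b\<bar> = 1" "\<bar>c\<bar> = 1"
    and A: "A \<in> monomial_matrices_3 a b c"
    using signed_perm_matrix_cases[OF assms(1)] .
  have "a = 1 \<or> a = - 1" "b = 1 \<or> b = - 1" "c = 1 \<or> c = - 1"
    using abc by linarith+
  then show ?thesis
    using A assms(2-) unfolding monomial_matrices_3_def
    by (elim insertE emptyE disjE) (simp_all add: matrix_3_simps)
qed

section \<open>Bounds from the central inversion and from reflections\<close>

lemma central_inversion_apply: "central_inversion n x = 2 *\<^sub>R cube_center n - x"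
proof -
  have "- mat 1 *v y = - y" for y :: "real^3"
    by (simp add: matrix_3_simps)
  then show ?thesis
    by (simp add: central_inversion_def cube_map_def scaleR_2)
qed

lemma central_inversion_card_le:
  assumes inv: "central_inversion n ` S = S" and S: "no_four_coplanar S"
  shows "card S \<le> 3"
proof (rule ccontr)
  assume "\<not> card S \<le> 3"
  then have large: "\<not> S \<subseteq> T" if "finite T" "card T \<le> 3" for T
    using card_mono[OF that(1), of S] that(2) by linarith
  let ?c = "cube_center n" and ?f = "central_inversion n"
  have f: "?f x \<in> S" if "x \<in> S" for x
    using inv that by blast
  have fix_iff: "?f x = x \<longleftrightarrow> x = ?c" for x
  proof -
    have "?f x = x \<longleftrightarrow> 2 *\<^sub>R ?c = 2 *\<^sub>R x"
      by (simp add: central_inversion_apply scaleR_2[of x] algebra_simps)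
    then show ?thesis
      by auto
  qed
  obtain x where x: "x \<in> S" "x \<noteq> ?c"
    using large[of "{?c}"] by auto
  \<comment> \<open>A fourth point \<open>y\<close> outside this set yields a second antipodal pair.
    Since only the centre is fixed, both pairs consist of two points.\<close>
  have "card {?c, x, ?f x} \<le> 3"
    by (simp add: card_insert_if)
  then obtain y where y: "y \<in> S" "y \<noteq> ?c" "y \<noteq> x" "y \<noteq> ?f x"
    using large[of "{?c, x, ?f x}"] by auto
  have "distinct [x, ?f x, y, ?f y]"
    using x y fix_iff[of x] fix_iff[of y] by (auto simp: central_inversion_apply)
  moreover have "{x, ?f x, y, ?f y} \<subseteq> S"
    using f x y by blast
  moreover have "coplanar {x, ?f x, y, ?f y}"
    by (rule coplanar_parallelogram) (simp add: central_inversion_apply)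
  ultimately show False
    using no_four_coplanarD[OF S] by blast
qed

text \<open>The bound is 3 + 2: at most three points on the mirror and at most one swapped pair off
  it.\<close>

lemma cube_reflection_card_le:
  assumes g: "cube_reflection n g" and inv: "g ` S = S" and S: "no_four_coplanar S"
  shows "card S \<le> 5"
proof -
  let ?c = "cube_center n"
  obtain A where A: "signed_perm_matrix A" "A ** A = mat 1" "det A = - 1" "A \<noteq> - mat 1"
    and gA: "g = cube_map n A"
    using g unfolding cube_reflection_def by blast
  obtain v k where v: "v \<noteq> 0" "k \<noteq> 0" and Av: "\<And>x. A *v x = x - (k * (v \<bullet> x)) *\<^sub>R v"
    using signed_perm_matrix_reflection[OF A] by blast
  have g_apply: "g x = x - (k * (v \<bullet> (x - ?c))) *\<^sub>R v" for x
    by (simp add: gA cube_map_def Av)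
  have "g \<circ> g = id"
    by (simp add: gA cube_map_comp A(2) cube_map_one)
  then have gg: "g (g x) = x" for x
    by (metis comp_apply id_apply)
  let ?F = "{x \<in> S. g x = x}" and ?N = "{x \<in> S. g x \<noteq> x}"
  have "card ?F \<le> 3"
  proof (rule ccontr)
    assume "\<not> card ?F \<le> 3"
    then obtain T where T: "T \<subseteq> ?F" "card T = 4"
      using obtain_subset_with_card_n[of 4 ?F] by auto
    \<comment> \<open>A fixed point has zero displacement along \<open>v\<close>, so it lies on the
      mirror through the centre.\<close>
    have "?F \<subseteq> {x. v \<bullet> x = v \<bullet> ?c}"
      using v by (auto simp: g_apply inner_diff_right)
    then have "coplanar T"
      using coplanar_hyperplane_3[OF v(1), of "v \<bullet> ?c"] T(1) by (meson coplanar_subset order_trans)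
    then show False
      using S T unfolding no_four_coplanar_def by blast
  qed
  moreover have "card ?N \<le> 2"
  proof (cases "?N = {}")
    case True
    show ?thesis
      unfolding True by simp
  next
    case False
    then obtain x where x: "x \<in> S" "g x \<noteq> x"
      by blast
    have "y \<in> {x, g x}" if y: "y \<in> ?N" for y
    proof (rule ccontr)
      assume "y \<notin> {x, g x}"
      then have "distinct [x, g x, y, g y]"
        using x y gg[of x] gg[of y] by auto
      moreover have "{x, g x, y, g y} \<subseteq> S"
        using inv x y by blast
      moreover have "coplanar {x, g x, y, g y}"
      proof -
        \<comment> \<open>Both displacements \<open>x - g x\<close> and \<open>y - g y\<close> are
          multiples of \<open>v\<close>, and \<open>t\<close> is their ratio; the denominator is
          nonzero because \<open>x\<close> is off the mirror.\<close>
        define t where "t = (v \<bullet> (y - ?c)) / (v \<bullet> (x - ?c))"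
        have "v \<bullet> (x - ?c) \<noteq> 0"
          using x(2) by (auto simp: g_apply)
        then have eq: "t * (k * (v \<bullet> (x - ?c))) = k * (v \<bullet> (y - ?c))"
          by (simp add: t_def)
        have "t *\<^sub>R (x - g x) = (t * (k * (v \<bullet> (x - ?c)))) *\<^sub>R v"
          by (simp add: g_apply)
        also have "\<dots> = y - g y"
          unfolding eq by (simp add: g_apply)
        finally have "t *\<^sub>R x - t *\<^sub>R g x = y - g y"
          by (simp only: scaleR_diff_right)
        then have "g y = (- t) *\<^sub>R x + t *\<^sub>R g x + 1 *\<^sub>R y"
          by (simp add: algebra_simps)
        then show ?thesis
          by (rule coplanar_affine_combination) simp
      qed
      ultimately show False
        using no_four_coplanarD[OF S] by blast
    qed
    then have "?N \<subseteq> {x, g x}"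
      by blast
    then have "card ?N \<le> card {x, g x}"
      by (intro card_mono) auto
    then show ?thesis
      by (simp add: card_insert_if split: if_splits)
  qed
  moreover have "?F \<union> ?N = S"
    by blast
  ultimately show ?thesis
    using card_Un_le[of ?F ?N] by simp
qed

section \<open>Element orders, iterates and matrix powers\<close>

lemma cube_map_funpow_eq_id_iff:
  assumes "signed_perm_matrix A"
  shows "cube_map n A ^^ k = id \<longleftrightarrow> group.ord (cube_group n) (cube_map n A) dvd k"
proof -
  interpret group "cube_group n"
    by (rule group_cube_group)
  have pow: "g [^]\<^bsub>cube_group n\<^esub> k = g ^^ k" for g k
    by (induction k) (simp_all add: nat_pow_def cube_group_def funpow_Suc_right del: funpow.simps(2))
  have "cube_map n A \<in> carrier (cube_group n)"
    using assms by (auto simp: cube_group_def)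
  from pow_eq_id[OF this] show ?thesis
    unfolding pow by (simp add: cube_group_def)
qed

lemma cube_map_funpow:
  "cube_map n (A ** A) = cube_map n A ^^ 2"
  "cube_map n (A ** A ** A) = cube_map n A ^^ 3"
  "cube_map n (A ** A ** A ** A) = cube_map n A ^^ 4"
  by (simp_all add: eval_nat_numeral comp_assoc flip: cube_map_comp)

text \<open>Order 6 excludes a trivial fourth power, so \<open>signed_perm_matrix_power\<close>
  leaves only the case where the cube of \<open>A\<close> is \<open>det A = - 1\<close> times the
  identity.\<close>

lemma rotatory_reflection6_funpow:
  assumes "rotatory_reflection6 n g"
  shows "g ^^ 3 = central_inversion n"
proof -
  obtain A where A: "signed_perm_matrix A" "det A = - 1" and gA: "g = cube_map n A"
    and ord: "group.ord (cube_group n) g = 6"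
    using assms unfolding rotatory_reflection6_def by blast
  have "g ^^ 4 \<noteq> id"
    using cube_map_funpow_eq_id_iff[OF A(1), where n = n and k = 4] ord by (simp add: gA)
  then have "A ** A ** A ** A \<noteq> mat 1"
    using cube_map_funpow(3)[of n A] by (auto simp: gA cube_map_one)
  then have "A ** A ** A = - mat 1"
    using signed_perm_matrix_power[OF A(1)] A(2) by simp
  then show ?thesis
    using cube_map_funpow(2)[of n A] by (simp add: gA central_inversion_def)
qed

lemma rotation4_subset_axis:
  assumes g: "rotation4 n g" and inv: "g ` S = S" and S: "no_four_coplanar S"
  shows "S \<subseteq> axis_of g"
proof
  fix x assume x: "x \<in> S"
  obtain A where A: "signed_perm_matrix A" "det A = 1" and gA: "g = cube_map n A"
    and ord: "group.ord (cube_group n) g = 4"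
    using g unfolding rotation4_def by blast
  have dvd: "g ^^ k = id \<longleftrightarrow> 4 dvd k" for k
    using cube_map_funpow_eq_id_iff[OF A(1), where n = n and k = k] ord by (simp add: gA)
  have "A ** A \<noteq> mat 1" "A ** A ** A \<noteq> mat 1"
    using cube_map_funpow(1,2)[of n A] dvd[of 2] dvd[of 3] by (auto simp: gA cube_map_one)
  then have A_eq: "mat 1 + A ** A = A + A ** A ** A"
    by (rule signed_perm_matrix_rotation4[OF A])
  have "y + A *v (A *v y) = A *v y + A *v (A *v (A *v y))" for y
    using arg_cong[OF A_eq, of "\<lambda>M. M *v y"]
    by (simp add: matrix_vector_mult_add_rdistrib matrix_vector_mul_assoc matrix_mul_assoc)
  \<comment> \<open>In the orbit of \<open>x\<close>, opposite points have the same sum, so they are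
    the diagonals of a parallelogram.\<close>
  from this[of "x - cube_center n"] have sum_eq: "x + g (g x) = g x + g (g (g x))"
    by (simp add: gA cube_map_def algebra_simps)
  have "g ^^ 4 = id"
    by (simp add: dvd)
  then have g4: "g (g (g (g x))) = x"
    by (simp add: eval_nat_numeral fun_eq_iff)
  show "x \<in> axis_of g"
  proof (rule ccontr)
    assume "x \<notin> axis_of g"
    then have gx: "g x \<noteq> x"
      by (simp add: axis_of_def)
    \<comment> \<open>The orbit cannot have length 2: the two diagonals would degenerate to
      \<open>x\<close> and \<open>g x\<close>, which share a midpoint only if they are
      equal.\<close>
    have ggx: "g (g x) \<noteq> x"
    proof
      assume "g (g x) = x"
      then have "2 *\<^sub>R x = 2 *\<^sub>R g x"
        using sum_eq by (simp add: scaleR_2)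
      then show False
        using gx by simp
    qed
    have "distinct [x, g (g x), g x, g (g (g x))]"
      using gx ggx g4 by (metis distinct_length_2_or_more distinct_singleton)
    moreover have "{x, g (g x), g x, g (g (g x))} \<subseteq> S"
      using inv x by blast
    moreover have "coplanar {x, g (g x), g x, g (g (g x))}"
      using sum_eq by (rule coplanar_parallelogram)
    ultimately show False
      using no_four_coplanarD[OF S] by blast
  qed
qed

theorem mainTheorem7:
  fixes n :: nat and H :: "(real^3 \<Rightarrow> real^3) set" and S :: "(real^3) set"
  assumes "n \<ge> 1"
    and "subgroup H (cube_group n)"
    and "S \<subseteq> grid_cube n"
    and "invariant_under H S"
    and "no_four_coplanar S"
  shows "(central_inversion n \<in> H \<or> (\<exists>g\<in>H. rotatory_reflection6 n g) \<longrightarrow> card S \<le> 3)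
    \<and> ((\<exists>g\<in>H. cube_reflection n g) \<longrightarrow> card S \<le> 5)
    \<and> (\<forall>g\<in>H. rotation4 n g \<longrightarrow> S \<subseteq> axis_of g)"
proof -
  have inv: "g ` S = S" if "g \<in> H" for g
    using assms(4) that unfolding invariant_under_def by blast
  \<comment> \<open>Invariance passes to the cube of \<open>g\<close>, which reduces a rotatory
    reflection of order 6 to the central inversion.\<close>
  have "(g ^^ 3) ` S = S" if "g \<in> H" for g
  proof -
    have "(g ^^ 3) ` S = g ` g ` g ` S"
      by (simp add: numeral_3_eq_3 image_comp comp_assoc)
    then show ?thesis
      by (simp add: inv[OF that])
  qed
  then have "central_inversion n ` S = S" if "g \<in> H" "rotatory_reflection6 n g" for g
    using rotatory_reflection6_funpow[OF that(2)] that(1) by metis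
  then have "card S \<le> 3" if "central_inversion n \<in> H \<or> (\<exists>g\<in>H. rotatory_reflection6 n g)"
    using that inv[of "central_inversion n"] central_inversion_card_le[OF _ assms(5)] by blast
  moreover have "card S \<le> 5" if "g \<in> H" "cube_reflection n g" for g
    using that cube_reflection_card_le inv assms(5) by blast
  moreover have "S \<subseteq> axis_of g" if "g \<in> H" "rotation4 n g" for g
    using that rotation4_subset_axis inv assms(5) by blast
  ultimately show ?thesis
    by blast
qed

end
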